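(* Let $d\ge1$ and let $\zeta_1(\cdot)$ and $\zeta_2(\cdot)$ be two centered Gaussian processes on $[0,1]^d$, with covariance functions in $L^2([0,1]^d\times[0,1]^d)$, and with Karhunen–Loève (KL) expansions $$\zeta_j(\mathbf t)\stackrel{\text{law}}{=}\sum_{k=1}^\infty\omega_k\sqrt{\lambda_{k,j}}\,e_{k,j}(\mathbf t),\qquad \mathbf t\in[0,1]^d,\quad j=1,2.$$ Then $$\int_{[0,1]^d}\zeta_1^2(\mathbf t)\,d\mathbf t\stackrel{\text{law}}{=}\int_{[0,1]^d}\zeta_2^2(\mathbf t)\,d\mathbf t$$ if and only if $\lambda_{k,1}=\lambda_{k,2}$ for all $k\ge1$.
   Context: $\stackrel{\text{law}}{=}$ denotes equality in distribution. For a centered Gaussian process $\{\zeta(\mathbf t):\mathbf t\in[0,1]^d\}$ with covariance function $K_\zeta(\mathbf s,\mathbf t)=E(\zeta(\mathbf s)\zeta(\mathbf t))$ in $L^2([0,1]^d\times[0,1]^d)$, the KL expansion is the representation $\zeta(\mathbf t)\stackrel{\text{law}}{=}\sum_{k\ge1}\omega_k\sqrt{\lambda_k}\,e_k(\mathbf t)$, convergent in expected mean squares (in particular $\sum_k\lambda_k<\infty$ and the $L^2([0,1]^d)$ norm of $\zeta$ is almost surely finite), where $\{\omega_k:k\ge 1\}$ are i.i.d. $N(0,1)$ random variables, $\{e_k:k\ge 1\}$ is an orthonormal sequence in $L^2([0,1]^d)$, and $\lambda_1\ge\lambda_2\ge\cdots\ge0$ are the eigenvalues (repeated according to multiplicity,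 listed in nonincreasing order, completed by zeros if necessary) of the Fredholm operator $T_\zeta h(\mathbf t)=\int_{[0,1]^d}K_\zeta(\mathbf s,\mathbf t)h(\mathbf s)\,d\mathbf s$ on $L^2([0,1]^d)$, with $T_\zeta e_k=\lambda_ke_k$. Consequently $\int_{[0,1]^d}\zeta^2(\mathbf t)\,d\mathbf t\stackrel{\text{law}}{=}\sum_{k\ge1}\lambda_k\omega_k^2$. *)

theory Defs
  imports "HOL-Probability.Probability"
begin

text \<open>
  The index set $[0,1]^d$ is \<open>cbox 0 1\<close> in \<open>real ^ 'n\<close> with \<open>d = CARD('n) \<ge> 1\<close>. Elements of
  \<open>L\<^sup>2\<close> are represented by square-integrable Borel functions; equality of such elements is
  equality almost everywhere. Series are indexed from 0 instead of 1.
\<close>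

abbreviation cube :: "(real ^ 'n::finite) set"
  where "cube \<equiv> cbox 0 1"

abbreviation cube_measure :: "(real ^ 'n::finite) measure"
  where "cube_measure \<equiv> restrict_space lborel cube"

definition square_integrable :: "'a measure \<Rightarrow> ('a \<Rightarrow> real) \<Rightarrow> bool"
  where "square_integrable M f \<longleftrightarrow> f \<in> borel_measurable M \<and> integrable M (\<lambda>x. (f x)\<^sup>2)"

text \<open>Degenerate (almost surely constant) variables count as Gaussian.\<close>

definition gaussian_rv :: "'a measure \<Rightarrow> ('a \<Rightarrow> real) \<Rightarrow> bool"
  where "gaussian_rv M X \<longleftrightarrow> X \<in> borel_measurable M \<and>
    (\<exists>m. (\<exists>\<sigma>>0. distributed M lborel X (normal_density m \<sigma>)) \<or> (AE x in M. X x = m))"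

definition gaussian_process :: "'a measure \<Rightarrow> 't set \<Rightarrow> ('t \<Rightarrow> 'a \<Rightarrow> real) \<Rightarrow> bool"
  where "gaussian_process M I \<zeta> \<longleftrightarrow>
    (\<forall>F c. finite F \<and> F \<subseteq> I \<longrightarrow> gaussian_rv M (\<lambda>x. \<Sum>t\<in>F. c t * \<zeta> t x))"

text \<open>
  Joint measurability is what makes the integral of the squared paths a random variable.
\<close>

definition centered_gaussian_process ::
  "'a measure \<Rightarrow> (real ^ 'n::finite \<Rightarrow> 'a \<Rightarrow> real) \<Rightarrow> bool"
  where "centered_gaussian_process M \<zeta> \<longleftrightarrow>
    prob_space M \<and>
    (\<lambda>(x, t). \<zeta> t x) \<in> borel_measurable (M \<Otimes>\<^sub>M cube_measure) \<and>
    gaussian_process M cube \<zeta> \<and>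
    (\<forall>t\<in>cube. prob_space.expectation M (\<zeta> t) = 0)"

definition covariance_fun :: "'a measure \<Rightarrow> ('t \<Rightarrow> 'a \<Rightarrow> real) \<Rightarrow> 't \<Rightarrow> 't \<Rightarrow> real"
  where "covariance_fun M \<zeta> s t = prob_space.expectation M (\<lambda>x. \<zeta> s x * \<zeta> t x)"

definition fredholm ::
  "(real ^ 'n::finite \<Rightarrow> real ^ 'n \<Rightarrow> real) \<Rightarrow> (real ^ 'n \<Rightarrow> real) \<Rightarrow> real ^ 'n \<Rightarrow> real"
  where "fredholm K h t = (\<integral>s. K s t * h s \<partial>cube_measure)"

definition orthonormal_seq :: "(nat \<Rightarrow> real ^ 'n::finite \<Rightarrow> real) \<Rightarrow> bool"
  where "orthonormal_seq e \<longleftrightarrow>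
    (\<forall>k. square_integrable cube_measure (e k)) \<and>
    (\<forall>j k. (\<integral>t. e j t * e k t \<partial>cube_measure) = (if j = k then 1 else 0))"

text \<open>
  The last clause expresses that \<open>l\<close> lists all nonzero eigenvalues with their multiplicities:
  the eigenspace of \<open>\<mu> \<noteq> 0\<close> is spanned by the finitely many \<open>e k\<close> with \<open>l k = \<mu>\<close>. The
  eigenvalue zero is exempt, since it only serves to complete a finite list.
\<close>

definition eigensystem ::
  "(real ^ 'n::finite \<Rightarrow> real ^ 'n \<Rightarrow> real) \<Rightarrow> (nat \<Rightarrow> real) \<Rightarrow> (nat \<Rightarrow> real ^ 'n \<Rightarrow> real) \<Rightarrow> bool"
  where "eigensystem K l e \<longleftrightarrow>
    decseq l \<and> (\<forall>k. 0 \<le> l k) \<and>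
    orthonormal_seq e \<and>
    (\<forall>k. AE t in cube_measure. fredholm K (e k) t = l k * e k t) \<and>
    (\<forall>\<mu>. \<mu> \<noteq> 0 \<longrightarrow> finite {k. l k = \<mu>} \<and>
      (\<forall>h. square_integrable cube_measure h \<and>
           (AE t in cube_measure. fredholm K h t = \<mu> * h t) \<longrightarrow>
           (\<exists>c. AE t in cube_measure. h t = (\<Sum>k | l k = \<mu>. c k * e k t))))"

definition iid_std_normal :: "'a measure \<Rightarrow> (nat \<Rightarrow> 'a \<Rightarrow> real) \<Rightarrow> bool"
  where "iid_std_normal N \<omega> \<longleftrightarrow>
    prob_space N \<and>
    prob_space.indep_vars N (\<lambda>_. borel) \<omega> UNIV \<and>
    (\<forall>k. distributed N lborel (\<omega> k) std_normal_density)"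

text \<open>Equality of all finite-dimensional distributions over an index set.\<close>

definition process_eq_law ::
  "'t set \<Rightarrow> 'a measure \<Rightarrow> ('t \<Rightarrow> 'a \<Rightarrow> real) \<Rightarrow> 'b measure \<Rightarrow> ('t \<Rightarrow> 'b \<Rightarrow> real) \<Rightarrow> bool"
  where "process_eq_law I M X N Y \<longleftrightarrow>
    (\<forall>F. finite F \<and> F \<subseteq> I \<longrightarrow>
      distr M (Pi\<^sub>M F (\<lambda>_. borel)) (\<lambda>x. \<lambda>t\<in>F. X t x) =
      distr N (Pi\<^sub>M F (\<lambda>_. borel)) (\<lambda>y. \<lambda>t\<in>F. Y t y))"

text \<open>\<open>Y\<close> is the sum of the series, in the sense of expected mean squares.\<close>

definition kl_series_sum ::
  "'b measure \<Rightarrow> (nat \<Rightarrow> 'b \<Rightarrow> real) \<Rightarrow> (nat \<Rightarrow> real) \<Rightarrow> (nat \<Rightarrow> real ^ 'n::finite \<Rightarrow> real) \<Rightarrow>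
   (real ^ 'n \<Rightarrow> 'b \<Rightarrow> real) \<Rightarrow> bool"
  where "kl_series_sum N \<omega> l e Y \<longleftrightarrow>
    (\<lambda>(y, t). Y t y) \<in> borel_measurable (N \<Otimes>\<^sub>M cube_measure) \<and>
    (\<lambda>n. \<integral>\<^sup>+ y. (\<integral>\<^sup>+ t. ennreal ((Y t y - (\<Sum>k<n. \<omega> k y * sqrt (l k) * e k t))\<^sup>2)
           \<partial>cube_measure) \<partial>N) \<longlonglongrightarrow> 0"

text \<open>
  The \<open>e k\<close>, and hence the sum \<open>Y\<close> of the series, are determined only up to null sets, so
  the equality in law is required off a null set \<open>Z\<close> of parameters. The case \<open>Z = {}\<close> is
  equality in law on all of the cube. The \<open>\<omega> k\<close> may live on a probability space other than
  that of \<open>\<zeta>\<close>. Summability of \<open>l\<close> and almost sure finiteness of the \<open>L\<^sup>2\<close> norm of \<open>\<zeta>\<close> are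
  consequences of the mean-square convergence.
\<close>

definition kl_expansion ::
  "'a measure \<Rightarrow> (real ^ 'n::finite \<Rightarrow> 'a \<Rightarrow> real) \<Rightarrow>
   'b measure \<Rightarrow> (nat \<Rightarrow> 'b \<Rightarrow> real) \<Rightarrow> (nat \<Rightarrow> real) \<Rightarrow> (nat \<Rightarrow> real ^ 'n \<Rightarrow> real) \<Rightarrow> bool"
  where "kl_expansion M \<zeta> N \<omega> l e \<longleftrightarrow>
    iid_std_normal N \<omega> \<and>
    eigensystem (covariance_fun M \<zeta>) l e \<and>
    (\<exists>Y. kl_series_sum N \<omega> l e Y \<and>
      (\<exists>Z\<in>null_sets cube_measure. process_eq_law (cube - Z) M \<zeta> N Y))"

end

theory Submission
  imports Defs "HOL-Complex_Analysis.Complex_Analysis"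
begin

text \<open>
  Both directions rest on the identity in law of \<open>\<integral>t. (\<zeta> t)\<^sup>2\<close> with \<open>\<Sum>k. l k * (\<omega> k)\<^sup>2\<close>, a quadratic
  form in independent standard normal variables. Two facts give it. First, the law of the integral
  depends only on the finite-dimensional distributions of the process, so \<open>\<zeta>\<close> may be replaced by the
  sum \<open>Y\<close> of its Karhunen-Loeve series (\<open>distr_integral_eq_if_process_eq_law\<close>): by Tonelli's theorem
  the moments of \<open>\<integral>t. f (\<zeta> t)\<close>, for bounded \<open>f\<close>, are integrals of finite-dimensional expectations.
  Second, by orthonormality the squared norms of the partial sums of the series are the partial sums
  of \<open>\<Sum>k. l k * (\<omega> k)\<^sup>2\<close>, and they converge almost surely to the squared norm of \<open>Y\<close>
  (\<open>kl_series_square_integral\<close>).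

  The law of the quadratic form is a function of \<open>l\<close> alone, which settles one direction. For the
  other one, its Laplace transform at \<open>s \<ge> 0\<close> is \<open>\<Prod>k. (1 + 2 * s * l k) powr (- 1 / 2)\<close>. Hence equal
  laws give equal products \<open>\<Prod>k. 1 + 2 * s * l k\<close> for all \<open>s \<ge> 0\<close>. Since \<open>l\<close> is summable, these
  products are entire functions of \<open>s\<close>, so they agree on the whole plane, and their zeros
  \<open>- 1 / (2 * l k)\<close> reveal the positive entries of \<open>l\<close> with their multiplicities
  (\<open>decseq_eq_if_products_eq\<close>). As \<open>l\<close> is nonincreasing and nonnegative, it is determined.
\<close>

section \<open>Laws on the line determined by expectations\<close>

lemma (in prob_space) integrable_bounded_continuous:
  fixes f :: "real \<Rightarrow> real"
  assumes "X \<in> borel_measurable M" and "continuous_on UNIV f" and "\<And>x. \<bar>f x\<bar> \<le> B"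
  shows "integrable M (\<lambda>x. f (X x))"
proof -
  have [measurable]: "f \<in> borel_measurable borel"
    using assms(2) by (rule borel_measurable_continuous_onI)
  show ?thesis
    using assms(1,3) by (intro integrable_const_bound[of _ B]) auto
qed

text \<open>
  The functions \<open>cos (t * x)\<close> and \<open>sin (t * x)\<close> are the real and imaginary parts of the
  characteristic function, so Levy's uniqueness theorem applies.
\<close>

lemma distr_eq_if_bounded_continuous:
  fixes X :: "'a \<Rightarrow> real" and Y :: "'b \<Rightarrow> real"
  assumes "prob_space M" and "prob_space N"
    and X[measurable]: "X \<in> borel_measurable M" and Y[measurable]: "Y \<in> borel_measurable N"
    and eq: "\<And>(f :: real \<Rightarrow> real) B. continuous_on UNIV f \<Longrightarrow> (\<And>x. \<bar>f x\<bar> \<le> B) \<Longrightarrow>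
      (\<integral>x. f (X x) \<partial>M) = (\<integral>y. f (Y y) \<partial>N)"
  shows "distr M borel X = distr N borel Y"
proof (rule Levy_uniqueness)
  interpret M: prob_space M by fact
  interpret N: prob_space N by fact
  show "real_distribution (distr M borel X)" "real_distribution (distr N borel Y)"
    by simp_all
  have char: "char (distr P borel V) t =
      complex_of_real (\<integral>x. cos (t * V x) \<partial>P) + \<i> * complex_of_real (\<integral>x. sin (t * V x) \<partial>P)"
    if "prob_space P" and [measurable]: "V \<in> borel_measurable P"
    for P :: "'c measure" and V and t :: real
  proof -
    interpret P: prob_space P by fact
    have "exp (\<i> * complex_of_real u) = complex_of_real (cos u) + \<i> * complex_of_real (sin u)" for u
      by (simp add: exp_Euler cos_of_real sin_of_real)
    from this[of "t * _"] have "char (distr P borel V) t =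
        (CLINT x|P. complex_of_real (cos (t * V x)) + \<i> * complex_of_real (sin (t * V x)))"
      by (simp add: char_def integral_distr)
    also have "\<dots> = (CLINT x|P. complex_of_real (cos (t * V x))) +
        (CLINT x|P. \<i> * complex_of_real (sin (t * V x)))"
      by (intro Bochner_Integration.integral_add integrable_mult_right integrable_of_real
          P.integrable_const_bound[of _ 1]) auto
    finally show ?thesis
      by simp
  qed
  show "char (distr M borel X) = char (distr N borel Y)"
  proof
    fix t :: real
    have "(\<integral>x. cos (t * X x) \<partial>M) = (\<integral>y. cos (t * Y y) \<partial>N)"
      by (rule eq[of "\<lambda>x. cos (t * x)" 1]) (auto intro!: continuous_intros)
    moreover have "(\<integral>x. sin (t * X x) \<partial>M) = (\<integral>y. sin (t * Y y) \<partial>N)"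
      by (rule eq[of "\<lambda>x. sin (t * x)" 1]) (auto intro!: continuous_intros)
    ultimately show "char (distr M borel X) t = char (distr N borel Y) t"
      using char[of M X t] char[of N Y t] assms(1-4) by simp
  qed
qed

text \<open>
  Moments determine the law only because the variables are bounded: on a compact interval every
  continuous function is a uniform limit of polynomials, by the theorem of Weierstrass.
\<close>

lemma distr_eq_if_moments_eq:
  fixes X :: "'a \<Rightarrow> real" and Y :: "'b \<Rightarrow> real"
  assumes "prob_space M" and "prob_space N"
    and X[measurable]: "X \<in> borel_measurable M" and Y[measurable]: "Y \<in> borel_measurable N"
    and bounds: "\<And>x. X x \<in> {a..b}" "\<And>y. Y y \<in> {a..b}"
    and moments: "\<And>n. (\<integral>x. X x ^ n \<partial>M) = (\<integral>y. Y y ^ n \<partial>N)"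
  shows "distr M borel X = distr N borel Y"
proof (rule distr_eq_if_bounded_continuous)
  interpret M: prob_space M by fact
  interpret N: prob_space N by fact
  fix f :: "real \<Rightarrow> real" and B
  assume f: "continuous_on UNIV f" and B: "\<And>x. \<bar>f x\<bar> \<le> B"
  have close: "\<bar>(\<integral>x. f (V x) \<partial>P) - (\<Sum>i\<le>n. c i * (\<integral>x. V x ^ i \<partial>P))\<bar> \<le> e"
    if "prob_space P" and [measurable]: "V \<in> borel_measurable P" and V: "\<And>x. V x \<in> {a..b}"
      and c: "\<And>x. x \<in> {a..b} \<Longrightarrow> \<bar>f x - (\<Sum>i\<le>n. c i * x ^ i)\<bar> < e"
    for P :: "'c measure" and V e n and c :: "nat \<Rightarrow> real"
  proof -
    interpret P: prob_space P by fact
    have int: "integrable P (\<lambda>x. V x ^ i)" for i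
    proof (rule P.integrable_const_bound[of _ "max \<bar>a\<bar> \<bar>b\<bar> ^ i"])
      have "\<bar>V x\<bar> \<le> max \<bar>a\<bar> \<bar>b\<bar>" for x
        using V[of x] by auto
      then show "AE x in P. norm (V x ^ i) \<le> max \<bar>a\<bar> \<bar>b\<bar> ^ i"
        by (auto simp: power_abs intro!: power_mono)
    qed simp
    have int_f: "integrable P (\<lambda>x. f (V x))"
      using f B by (intro P.integrable_bounded_continuous) auto
    have "(\<integral>x. f (V x) \<partial>P) - (\<Sum>i\<le>n. c i * (\<integral>x. V x ^ i \<partial>P)) =
        (\<integral>x. f (V x) - (\<Sum>i\<le>n. c i * V x ^ i) \<partial>P)"
      by (simp add: int int_f)
    also have "\<bar>\<dots>\<bar> \<le> (\<integral>x. \<bar>f (V x) - (\<Sum>i\<le>n. c i * V x ^ i)\<bar> \<partial>P)"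
      by (rule integral_abs_bound)
    also have "\<dots> \<le> (\<integral>x. e \<partial>P)"
      by (intro integral_mono integrable_abs Bochner_Integration.integrable_diff int_f
          Bochner_Integration.integrable_sum integrable_mult_right int)
        (use c V in \<open>auto intro: less_imp_le\<close>)
    finally show ?thesis
      by (simp add: P.prob_space)
  qed
  have "\<bar>(\<integral>x. f (X x) \<partial>M) - (\<integral>y. f (Y y) \<partial>N)\<bar> \<le> e" if "0 < e" for e
  proof -
    have "continuous_on {a..b} f" "0 < e / 2"
      using f continuous_on_subset that by auto
    then obtain p where "real_polynomial_function p"
      and p: "\<And>x. x \<in> {a..b} \<Longrightarrow> \<bar>f x - p x\<bar> < e / 2"
      by (rule Stone_Weierstrass_real_polynomial_function[OF compact_Icc]) blast
    then obtain c n where "p = (\<lambda>x. \<Sum>i\<le>n. c i * x ^ i)"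
      by (auto simp: real_polynomial_function_iff_sum)
    with p have c: "\<And>x. x \<in> {a..b} \<Longrightarrow> \<bar>f x - (\<Sum>i\<le>n. c i * x ^ i)\<bar> < e / 2"
      by simp
    show ?thesis
      using close[OF \<open>prob_space M\<close> X bounds(1) c] close[OF \<open>prob_space N\<close> Y bounds(2) c]
      unfolding moments by linarith
  qed
  then show "(\<integral>x. f (X x) \<partial>M) = (\<integral>y. f (Y y) \<partial>N)"
    using field_le_epsilon[of "\<bar>(\<integral>x. f (X x) \<partial>M) - (\<integral>y. f (Y y) \<partial>N)\<bar>" 0] by simp
qed fact+

lemma distr_eq_limit:
  fixes X :: "nat \<Rightarrow> 'a \<Rightarrow> real" and Y :: "nat \<Rightarrow> 'b \<Rightarrow> real"
  assumes "prob_space M" and "prob_space N"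
    and [measurable]: "\<And>m. X m \<in> borel_measurable M" "\<And>m. Y m \<in> borel_measurable N"
      "X' \<in> borel_measurable M" "Y' \<in> borel_measurable N"
    and eq: "\<And>m. distr M borel (X m) = distr N borel (Y m)"
    and X_lim: "\<And>x. x \<in> space M \<Longrightarrow> (\<lambda>m. X m x) \<longlonglongrightarrow> X' x"
    and Y_lim: "\<And>y. y \<in> space N \<Longrightarrow> (\<lambda>m. Y m y) \<longlonglongrightarrow> Y' y"
  shows "distr M borel X' = distr N borel Y'"
proof (rule distr_eq_if_bounded_continuous)
  interpret M: prob_space M by fact
  interpret N: prob_space N by fact
  fix f :: "real \<Rightarrow> real" and B
  assume f: "continuous_on UNIV f" and B: "\<And>x. \<bar>f x\<bar> \<le> B"
  have [measurable]: "f \<in> borel_measurable borel"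
    using f by (rule borel_measurable_continuous_onI)
  have cont: "(\<lambda>m. f (u m)) \<longlonglongrightarrow> f l" if "u \<longlonglongrightarrow> l" for u l
    using continuous_on_tendsto_compose[OF f that] by simp
  have "(\<lambda>m. \<integral>x. f (X m x) \<partial>M) \<longlonglongrightarrow> (\<integral>x. f (X' x) \<partial>M)"
    using B by (intro integral_dominated_convergence[where w = "\<lambda>_. B"]) (auto intro!: cont X_lim)
  moreover have "(\<lambda>m. \<integral>y. f (Y m y) \<partial>N) \<longlonglongrightarrow> (\<integral>y. f (Y' y) \<partial>N)"
    using B by (intro integral_dominated_convergence[where w = "\<lambda>_. B"]) (auto intro!: cont Y_lim)
  moreover have "(\<integral>x. f (X m x) \<partial>M) = (\<integral>y. f (Y m y) \<partial>N)" for m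
    using arg_cong[OF eq[of m], where f = "\<lambda>D. \<integral>x. f x \<partial>D"] by (simp add: integral_distr)
  ultimately show "(\<integral>x. f (X' x) \<partial>M) = (\<integral>y. f (Y' y) \<partial>N)"
    by (simp add: LIMSEQ_unique)
qed fact+

section \<open>Integrals of a process along its paths\<close>

lemma measurable_restrict_process:
  assumes "\<And>t. t \<in> F \<Longrightarrow> X t \<in> borel_measurable M"
  shows "(\<lambda>x. \<lambda>t\<in>F. X t x) \<in> measurable M (Pi\<^sub>M F (\<lambda>_. borel))"
  using assms by (intro measurable_restrict) auto

lemma joint_measurable:
  fixes X :: "'t \<Rightarrow> 'a \<Rightarrow> real"
  assumes "(\<lambda>(x, t). X t x) \<in> borel_measurable (M \<Otimes>\<^sub>M T)"
  shows joint_measurable_section: "t \<in> space T \<Longrightarrow> X t \<in> borel_measurable M"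
    and joint_measurable_path: "x \<in> space M \<Longrightarrow> (\<lambda>t. X t x) \<in> borel_measurable T"
  using measurable_compose[OF measurable_Pair2' assms, of t]
    measurable_compose[OF measurable_Pair1' assms, of x] by simp_all

text \<open>
  One factor of the power is written as an integral over a new time \<open>t\<close> and pulled out by
  Tonelli's theorem. The remaining power is weighted by a functional of the finitely many values
  \<open>X s\<close> with \<open>s \<in> insert t F\<close>. Iteration reduces every moment of the path integral to the
  finite-dimensional distributions.
\<close>

lemma moment_peel:
  fixes X :: "'t \<Rightarrow> 'a \<Rightarrow> real" and g :: "real \<Rightarrow> ennreal"
  assumes "sigma_finite_measure M" and "sigma_finite_measure T"
    and X[measurable]: "(\<lambda>(x, t). X t x) \<in> borel_measurable (M \<Otimes>\<^sub>M T)"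
    and g[measurable]: "g \<in> borel_measurable borel"
    and F: "F \<subseteq> space T" and h: "h \<in> borel_measurable (Pi\<^sub>M F (\<lambda>_. borel))"
  shows "(\<integral>\<^sup>+x. h (\<lambda>s\<in>F. X s x) * (\<integral>\<^sup>+t. g (X t x) \<partial>T) ^ Suc n \<partial>M) =
    (\<integral>\<^sup>+t. (\<integral>\<^sup>+x. (h (\<lambda>s\<in>F. X s x) * g (X t x)) * (\<integral>\<^sup>+t. g (X t x) \<partial>T) ^ n \<partial>M) \<partial>T)"
proof -
  interpret M: sigma_finite_measure M by fact
  interpret T: sigma_finite_measure T by fact
  interpret pair_sigma_finite M T ..
  have [measurable]: "(\<lambda>x. h (\<lambda>s\<in>F. X s x)) \<in> borel_measurable M"
    using F by (intro measurable_compose[OF measurable_restrict_process h]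
        joint_measurable_section[OF X]) auto
  have [measurable]: "(\<lambda>x. X (snd x) (fst x)) \<in> borel_measurable (M \<Otimes>\<^sub>M T)"
    using X by (simp add: case_prod_unfold)
  have "(\<integral>\<^sup>+x. h (\<lambda>s\<in>F. X s x) * (\<integral>\<^sup>+t. g (X t x) \<partial>T) ^ Suc n \<partial>M) =
      (\<integral>\<^sup>+x. (\<integral>\<^sup>+t. (h (\<lambda>s\<in>F. X s x) * (\<integral>\<^sup>+t. g (X t x) \<partial>T) ^ n) * g (X t x) \<partial>T) \<partial>M)"
    by (intro nn_integral_cong, subst nn_integral_cmult)
      (auto simp: ac_simps intro!: measurable_compose[OF joint_measurable_path[OF X] g])
  also have "\<dots> = (\<integral>\<^sup>+t. (\<integral>\<^sup>+x. (h (\<lambda>s\<in>F. X s x) * (\<integral>\<^sup>+t. g (X t x) \<partial>T) ^ n) * g (X t x) \<partial>M) \<partial>T)"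
    by (rule Fubini'[symmetric]) measurable
  finally show ?thesis
    by (simp add: ac_simps)
qed

text \<open>
  The weight \<open>h\<close>, an arbitrary functional of finitely many values of the process, is what makes the
  induction on \<open>n\<close> work: each step adds one time to \<open>F\<close>. The new time is an integration variable, so
  it can be taken outside of the null set \<open>Z\<close>.
\<close>

lemma nn_moments_eq_if_process_eq_law:
  fixes X :: "'t \<Rightarrow> 'a \<Rightarrow> real" and Y :: "'t \<Rightarrow> 'b \<Rightarrow> real" and g :: "real \<Rightarrow> ennreal"
  assumes sf: "sigma_finite_measure M" "sigma_finite_measure N" "sigma_finite_measure T"
    and X: "(\<lambda>(x, t). X t x) \<in> borel_measurable (M \<Otimes>\<^sub>M T)"
    and Y: "(\<lambda>(y, t). Y t y) \<in> borel_measurable (N \<Otimes>\<^sub>M T)"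
    and Z: "Z \<in> null_sets T" and law: "process_eq_law (space T - Z) M X N Y"
    and g[measurable]: "g \<in> borel_measurable borel"
    and "finite F" and "F \<subseteq> space T - Z" and "h \<in> borel_measurable (Pi\<^sub>M F (\<lambda>_. borel))"
  shows "(\<integral>\<^sup>+x. h (\<lambda>s\<in>F. X s x) * (\<integral>\<^sup>+t. g (X t x) \<partial>T) ^ n \<partial>M) =
    (\<integral>\<^sup>+y. h (\<lambda>s\<in>F. Y s y) * (\<integral>\<^sup>+t. g (Y t y) \<partial>T) ^ n \<partial>N)"
  using assms(9-)
proof (induction n arbitrary: F h)
  case 0
  have mX: "(\<lambda>x. \<lambda>t\<in>F. X t x) \<in> measurable M (Pi\<^sub>M F (\<lambda>_. borel))"
    and mY: "(\<lambda>y. \<lambda>t\<in>F. Y t y) \<in> measurable N (Pi\<^sub>M F (\<lambda>_. borel))"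
    using 0 by (auto intro!: measurable_restrict_process joint_measurable_section[OF X]
        joint_measurable_section[OF Y])
  have "(\<integral>\<^sup>+x. h (\<lambda>t\<in>F. X t x) \<partial>M) =
      (\<integral>\<^sup>+w. h w \<partial>distr M (Pi\<^sub>M F (\<lambda>_. borel)) (\<lambda>x. \<lambda>t\<in>F. X t x))"
    using 0(3) by (subst nn_integral_distr[OF mX]) simp_all
  also have "\<dots> = (\<integral>\<^sup>+w. h w \<partial>distr N (Pi\<^sub>M F (\<lambda>_. borel)) (\<lambda>y. \<lambda>t\<in>F. Y t y))"
    using law 0 by (simp add: process_eq_law_def)
  also have "\<dots> = (\<integral>\<^sup>+y. h (\<lambda>t\<in>F. Y t y) \<partial>N)"
    using 0(3) by (subst nn_integral_distr[OF mY]) simp_all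
  finally show ?case
    by (simp only: power_0 mult_1_right)
next
  case (Suc n)
  have F: "F \<subseteq> space T"
    using Suc.prems by auto
  have step: "(\<integral>\<^sup>+x. (h (\<lambda>s\<in>F. X s x) * g (X t x)) * (\<integral>\<^sup>+t. g (X t x) \<partial>T) ^ n \<partial>M) =
      (\<integral>\<^sup>+y. (h (\<lambda>s\<in>F. Y s y) * g (Y t y)) * (\<integral>\<^sup>+t. g (Y t y) \<partial>T) ^ n \<partial>N)"
    if t: "t \<in> space T - Z" for t
  proof -
    let ?h = "\<lambda>w. h (restrict w F) * g (w t)"
    have [measurable]: "(\<lambda>w. restrict w F) \<in> measurable (Pi\<^sub>M (insert t F) (\<lambda>_. borel)) (Pi\<^sub>M F (\<lambda>_. borel))"
      by (rule measurable_restrict_subset) auto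
    note Suc.prems(3)[measurable]
    have "?h \<in> borel_measurable (Pi\<^sub>M (insert t F) (\<lambda>_. borel))"
      by measurable
    moreover have "finite (insert t F)" "insert t F \<subseteq> space T - Z"
      using Suc.prems t by auto
    moreover have "restrict (\<lambda>s\<in>insert t F. v s) F = (\<lambda>s\<in>F. v s)" "(\<lambda>s\<in>insert t F. v s) t = v t"
      for v :: "'t \<Rightarrow> real"
      by auto
    ultimately show ?thesis
      using Suc.IH[of "insert t F" ?h] by (simp only:)
  qed
  have "AE t in T. t \<in> space T - Z"
    using AE_space AE_not_in[OF Z] by eventually_elim simp
  then have "AE t in T. (\<integral>\<^sup>+x. (h (\<lambda>s\<in>F. X s x) * g (X t x)) * (\<integral>\<^sup>+t. g (X t x) \<partial>T) ^ n \<partial>M) =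
      (\<integral>\<^sup>+y. (h (\<lambda>s\<in>F. Y s y) * g (Y t y)) * (\<integral>\<^sup>+t. g (Y t y) \<partial>T) ^ n \<partial>N)"
    by (rule eventually_mono) (rule step)
  then show ?case
    unfolding moment_peel[OF sf(1,3) X g F Suc.prems(3)] moment_peel[OF sf(2,3) Y g F Suc.prems(3)]
    by (rule nn_integral_cong_AE)
qed

text \<open>
  The bounded quantity \<open>inverse (1 + a)\<close> determines \<open>a\<close>, including \<open>a = \<infinity>\<close>, which it sends to zero.
  The value \<open>0\<close> for \<open>b = 0\<close> agrees with \<open>enn2real \<infinity> = 0\<close>.
\<close>

lemma enn2real_eq_inverse:
  "enn2real a = (let b = enn2real (inverse (1 + a)) in if b = 0 then 0 else 1 / b - 1)"
proof (cases a)
  case (real r)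
  then have "inverse (1 + a) = ennreal (1 / (1 + r))"
    by (simp add: inverse_ennreal inverse_eq_divide flip: ennreal_1 ennreal_plus)
  with real show ?thesis
    by (simp add: Let_def)
qed simp

text \<open>
  Finite-dimensional distributions off a null set determine the law of a path integral. For the
  truncated integrands \<open>min (f u) m\<close> the path integral is a bounded variable, and its moments agree.
  As \<open>m\<close> tends to infinity, the truncated integrals increase to the full one, which may be infinite.
  The limit is therefore taken after applying \<open>a \<mapsto> inverse (1 + a)\<close>, which is continuous
  on \<open>[0, \<infinity>]\<close>. The default value of a divergent Bochner integral is zero and thus equal to
  \<open>enn2real \<infinity>\<close>, so divergent paths are treated like all others.
\<close>

lemma distr_integral_eq_if_process_eq_law:
  fixes X :: "'t \<Rightarrow> 'a \<Rightarrow> real" and Y :: "'t \<Rightarrow> 'b \<Rightarrow> real" and f :: "real \<Rightarrow> real"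
  assumes "prob_space M" and "prob_space N" and "finite_measure T"
    and X: "(\<lambda>(x, t). X t x) \<in> borel_measurable (M \<Otimes>\<^sub>M T)"
    and Y: "(\<lambda>(y, t). Y t y) \<in> borel_measurable (N \<Otimes>\<^sub>M T)"
    and Z: "Z \<in> null_sets T" and law: "process_eq_law (space T - Z) M X N Y"
    and f[measurable]: "f \<in> borel_measurable borel" and nonneg: "\<And>u. 0 \<le> f u"
  shows "distr M borel (\<lambda>x. \<integral>t. f (X t x) \<partial>T) = distr N borel (\<lambda>y. \<integral>t. f (Y t y) \<partial>T)"
proof -
  interpret M: prob_space M by fact
  interpret N: prob_space N by fact
  interpret T: finite_measure T by fact
  have [measurable]: "(\<lambda>x. X (snd x) (fst x)) \<in> borel_measurable (M \<Otimes>\<^sub>M T)"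
    "(\<lambda>x. Y (snd x) (fst x)) \<in> borel_measurable (N \<Otimes>\<^sub>M T)"
    using X Y by (simp_all add: case_prod_unfold)
  note path = joint_measurable_path[OF X] joint_measurable_path[OF Y]
  define g where "g m u = ennreal (min (f u) (real m))" for m u
  have [measurable]: "g m \<in> borel_measurable borel" for m
    unfolding g_def by measurable
  define c where "c = measure T (space T)"
  have bound: "(\<integral>\<^sup>+t. g m (V t) \<partial>T) \<le> ennreal (m * c)" for m V
  proof -
    have "(\<integral>\<^sup>+t. g m (V t) \<partial>T) \<le> (\<integral>\<^sup>+t. ennreal m \<partial>T)"
      unfolding g_def by (intro nn_integral_mono ennreal_leI) simp
    then show ?thesis
      by (simp add: c_def T.emeasure_eq_measure ennreal_mult'')
  qed
  have finite: "ennreal (enn2real (\<integral>\<^sup>+t. g m (V t) \<partial>T)) = (\<integral>\<^sup>+t. g m (V t) \<partial>T)" for m V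
    using bound[of m V] by (simp add: le_less_trans[OF _ ennreal_less_top])
  define A where "A m x = enn2real (\<integral>\<^sup>+t. g m (X t x) \<partial>T)" for m x
  define B where "B m y = enn2real (\<integral>\<^sup>+t. g m (Y t y) \<partial>T)" for m y
  have [measurable]: "A m \<in> borel_measurable M" "B m \<in> borel_measurable N" for m
    unfolding A_def B_def by measurable
  have range: "A m x \<in> {0..m * c}" "B m x' \<in> {0..m * c}" for m x x'
    using enn2real_mono[OF bound] by (auto simp: A_def B_def c_def)
  have truncated: "distr M borel (A m) = distr N borel (B m)" for m
  proof (rule distr_eq_if_moments_eq[OF \<open>prob_space M\<close> \<open>prob_space N\<close> _ _ range])
    fix n
    have "(\<integral>\<^sup>+x. ennreal (A m x ^ n) \<partial>M) = (\<integral>\<^sup>+y. ennreal (B m y ^ n) \<partial>N)"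
      using nn_moments_eq_if_process_eq_law[OF M.sigma_finite_measure_axioms
          N.sigma_finite_measure_axioms T.sigma_finite_measure_axioms X Y Z law, of "g m" "{}" "\<lambda>_. 1" n]
      by (simp add: A_def B_def finite flip: ennreal_power)
    then show "(\<integral>x. A m x ^ n \<partial>M) = (\<integral>y. B m y ^ n \<partial>N)"
      using range by (simp add: integral_eq_nn_integral)
  qed simp_all
  have lim: "(\<lambda>m. enn2real (inverse (1 + ennreal (enn2real (\<integral>\<^sup>+t. g m (V t) \<partial>T))))) \<longlonglongrightarrow>
      enn2real (inverse (1 + (\<integral>\<^sup>+t. ennreal (f (V t)) \<partial>T)))"
    if [measurable]: "V \<in> borel_measurable T" for V
  proof -
    have "(\<lambda>m. \<integral>\<^sup>+t. g m (V t) \<partial>T) \<longlonglongrightarrow> (\<integral>\<^sup>+t. ennreal (f (V t)) \<partial>T)"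
    proof (rule nn_integral_LIMSEQ)
      show "incseq (\<lambda>m t. g m (V t))"
        by (auto simp: incseq_def le_fun_def g_def intro!: ennreal_leI)
      fix t
      obtain k where "f (V t) \<le> real k"
        using real_arch_simple by blast
      then have "\<forall>m\<ge>k. g m (V t) = ennreal (f (V t))"
        by (auto simp: g_def min_def)
      then show "(\<lambda>m. g m (V t)) \<longlonglongrightarrow> ennreal (f (V t))"
        by (intro tendsto_eventually) (auto simp: eventually_sequentially)
    qed measurable
    then have "(\<lambda>m. 1 + (\<integral>\<^sup>+t. g m (V t) \<partial>T)) \<longlonglongrightarrow> 1 + (\<integral>\<^sup>+t. ennreal (f (V t)) \<partial>T)"
      by (intro tendsto_add tendsto_const)
    then have "(\<lambda>m. inverse (1 + (\<integral>\<^sup>+t. g m (V t) \<partial>T))) \<longlonglongrightarrow> inverse (1 + (\<integral>\<^sup>+t. ennreal (f (V t)) \<partial>T))"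
      by (rule continuous_on_tendsto_compose[OF continuous_on_inverse_ennreal[OF continuous_on_id, of UNIV]]) auto
    moreover have "inverse (1 + (\<integral>\<^sup>+t. ennreal (f (V t)) \<partial>T)) =
        ennreal (enn2real (inverse (1 + (\<integral>\<^sup>+t. ennreal (f (V t)) \<partial>T))))"
      by (simp add: less_top[symmetric])
    ultimately have "(\<lambda>m. enn2real (inverse (1 + (\<integral>\<^sup>+t. g m (V t) \<partial>T)))) \<longlonglongrightarrow>
        enn2real (inverse (1 + (\<integral>\<^sup>+t. ennreal (f (V t)) \<partial>T)))"
      by (metis tendsto_enn2real enn2real_nonneg)
    then show ?thesis
      by (simp add: finite)
  qed
  \<comment> \<open>\<open>\<phi>\<close> undoes the transformation \<open>\<psi>\<close> in the limit.\<close>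
  define \<phi> where "\<phi> b = (if b = 0 then 0 else 1 / b - 1)" for b :: real
  have \<phi>: "\<phi> (enn2real (inverse (1 + a))) = enn2real a" for a
    by (subst (2) enn2real_eq_inverse) (simp add: \<phi>_def Let_def)
  have [measurable]: "\<phi> \<in> borel_measurable borel"
    unfolding \<phi>_def by measurable
  define \<psi> where "\<psi> a = enn2real (inverse (1 + ennreal a))" for a
  have [measurable]: "\<psi> \<in> borel_measurable borel"
    unfolding \<psi>_def by measurable
  define C where "C x = enn2real (inverse (1 + (\<integral>\<^sup>+t. ennreal (f (X t x)) \<partial>T)))" for x
  define D where "D y = enn2real (inverse (1 + (\<integral>\<^sup>+t. ennreal (f (Y t y)) \<partial>T)))" for y
  have [measurable]: "C \<in> borel_measurable M" "D \<in> borel_measurable N"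
    unfolding C_def D_def by measurable
  have "distr M borel C = distr N borel D"
  proof (rule distr_eq_limit[OF \<open>prob_space M\<close> \<open>prob_space N\<close>])
    show "distr M borel (\<lambda>x. \<psi> (A m x)) = distr N borel (\<lambda>y. \<psi> (B m y))" for m
      using arg_cong[OF truncated[of m], where f = "\<lambda>D. distr D borel \<psi>"]
      by (simp add: distr_distr comp_def)
    show "(\<lambda>m. \<psi> (A m x)) \<longlonglongrightarrow> C x" if "x \<in> space M" for x
      using lim[OF path(1)[OF that]] by (simp add: \<psi>_def A_def C_def)
    show "(\<lambda>m. \<psi> (B m y)) \<longlonglongrightarrow> D y" if "y \<in> space N" for y
      using lim[OF path(2)[OF that]] by (simp add: \<psi>_def B_def D_def)
  qed simp_all
  from arg_cong[OF this, where f = "\<lambda>D. distr D borel \<phi>"]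
  have "distr M borel (\<lambda>x. \<phi> (C x)) = distr N borel (\<lambda>y. \<phi> (D y))"
    by (simp add: distr_distr comp_def)
  moreover have "(\<integral>t. f (X t x) \<partial>T) = \<phi> (C x)" if "x \<in> space M" for x
    unfolding C_def \<phi> using path(1)[OF that] nonneg by (intro integral_eq_nn_integral) auto
  moreover have "(\<integral>t. f (Y t y) \<partial>T) = \<phi> (D y)" if "y \<in> space N" for y
    unfolding D_def \<phi> using path(2)[OF that] nonneg by (intro integral_eq_nn_integral) auto
  ultimately show ?thesis
    by (simp cong: distr_cong)
qed


section \<open>The squared norm of the sum of a Karhunen-Loeve series\<close>

lemma incseq_tendsto_if_frequently_close:
  fixes w :: "nat \<Rightarrow> real"
  assumes "incseq w" and close: "\<And>e. 0 < e \<Longrightarrow> \<exists>\<^sub>F n in sequentially. \<bar>w n - c\<bar> < e"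
  shows "w \<longlonglongrightarrow> c"
proof -
  have le: "w n \<le> c" for n
  proof (rule ccontr)
    assume "\<not> w n \<le> c"
    then have "\<exists>\<^sub>F m in sequentially. \<bar>w m - c\<bar> < w n - c"
      by (intro close) simp
    then obtain m where "n \<le> m" "\<bar>w m - c\<bar> < w n - c"
      by (auto simp: frequently_sequentially)
    with incseqD[OF \<open>incseq w\<close> \<open>n \<le> m\<close>] show False
      by simp
  qed
  show ?thesis
  proof (rule LIMSEQ_I)
    fix e :: real assume "0 < e"
    then obtain m where m: "\<bar>w m - c\<bar> < e"
      using close[of e] by (auto simp: frequently_sequentially)
    have "norm (w n - c) < e" if "m \<le> n" for n
      using m le[of n] incseqD[OF \<open>incseq w\<close> that] by simp
    then show "\<exists>m. \<forall>n\<ge>m. norm (w n - c) < e"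
      by blast
  qed
qed

text \<open>
  With \<open>h = f - g\<close> one has \<open>g\<^sup>2 - f\<^sup>2 = h\<^sup>2 - 2 * f * h\<close>, and the mixed term is at most
  \<open>\<delta> * f\<^sup>2 + h\<^sup>2 / \<delta>\<close>. Thus closeness in \<open>L\<^sup>2\<close> gives closeness of the squared norms.
\<close>

lemma integral_square_diff_bound:
  fixes f g :: "'t \<Rightarrow> real"
  assumes [measurable]: "f \<in> borel_measurable T" and g: "square_integrable T g"
    and dist: "(\<integral>\<^sup>+t. ennreal ((f t - g t)\<^sup>2) \<partial>T) < ennreal d" and "0 < \<delta>"
  shows "\<bar>(\<integral>t. (g t)\<^sup>2 \<partial>T) - (\<integral>t. (f t)\<^sup>2 \<partial>T)\<bar> \<le> (1 + 1 / \<delta>) * d + \<delta> * (\<integral>t. (f t)\<^sup>2 \<partial>T)"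
proof -
  have [measurable]: "g \<in> borel_measurable T" and int_g: "integrable T (\<lambda>t. (g t)\<^sup>2)"
    using g by (auto simp: square_integrable_def)
  have int_diff: "integrable T (\<lambda>t. (f t - g t)\<^sup>2)"
    using dist by (intro integrableI_bounded) (auto intro: less_trans[OF _ ennreal_less_top])
  have int_f: "integrable T (\<lambda>t. (f t)\<^sup>2)"
  proof (rule Bochner_Integration.integrable_bound)
    show "integrable T (\<lambda>t. 2 * (f t - g t)\<^sup>2 + 2 * (g t)\<^sup>2)"
      using int_diff int_g by simp
    have "(f t)\<^sup>2 \<le> 2 * (f t - g t)\<^sup>2 + 2 * (g t)\<^sup>2" for t
      using zero_le_power2[of "f t - 2 * g t"] by (simp add: power2_eq_square algebra_simps)
    then show "AE t in T. norm ((f t)\<^sup>2) \<le> norm (2 * (f t - g t)\<^sup>2 + 2 * (g t)\<^sup>2)"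
      by (simp add: abs_of_nonneg)
  qed measurable
  have "(\<integral>t. (f t - g t)\<^sup>2 \<partial>T) \<le> d"
  proof -
    have "ennreal (\<integral>t. (f t - g t)\<^sup>2 \<partial>T) < ennreal d"
      using dist int_diff by (simp add: nn_integral_eq_integral)
    then show ?thesis
      by (simp add: ennreal_less_iff)
  qed
  have pointwise: "\<bar>(g t)\<^sup>2 - (f t)\<^sup>2\<bar> \<le> (1 + 1 / \<delta>) * (f t - g t)\<^sup>2 + \<delta> * (f t)\<^sup>2" for t
  proof -
    define h where "h = f t - g t"
    have "0 \<le> (\<delta> * f t - h)\<^sup>2 / \<delta>" "0 \<le> (\<delta> * f t + h)\<^sup>2 / \<delta>"
      using \<open>0 < \<delta>\<close> by simp_all
    then have "\<bar>2 * f t * h\<bar> \<le> \<delta> * (f t)\<^sup>2 + h\<^sup>2 / \<delta>"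
      using \<open>0 < \<delta>\<close> by (simp add: abs_le_iff power2_eq_square field_simps)
    moreover have "(g t)\<^sup>2 - (f t)\<^sup>2 = h\<^sup>2 - 2 * f t * h"
      by (simp add: h_def power2_eq_square algebra_simps)
    moreover have "(1 + 1 / \<delta>) * h\<^sup>2 = h\<^sup>2 + h\<^sup>2 / \<delta>"
      by (simp add: algebra_simps)
    ultimately show ?thesis
      unfolding h_def[symmetric] using zero_le_power2[of h] by linarith
  qed
  have "\<bar>(\<integral>t. (g t)\<^sup>2 \<partial>T) - (\<integral>t. (f t)\<^sup>2 \<partial>T)\<bar> \<le> (\<integral>t. \<bar>(g t)\<^sup>2 - (f t)\<^sup>2\<bar> \<partial>T)"
    using int_f int_g integral_abs_bound[of T "\<lambda>t. (g t)\<^sup>2 - (f t)\<^sup>2"] by simp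
  also have "\<dots> \<le> (\<integral>t. (1 + 1 / \<delta>) * (f t - g t)\<^sup>2 + \<delta> * (f t)\<^sup>2 \<partial>T)"
    using int_f int_g int_diff pointwise by (intro integral_mono) auto
  also have "\<dots> = (1 + 1 / \<delta>) * (\<integral>t. (f t - g t)\<^sup>2 \<partial>T) + \<delta> * (\<integral>t. (f t)\<^sup>2 \<partial>T)"
    using int_f int_diff by simp
  also have "\<dots> \<le> (1 + 1 / \<delta>) * d + \<delta> * (\<integral>t. (f t)\<^sup>2 \<partial>T)"
    using \<open>0 < \<delta>\<close> \<open>_ \<le> d\<close> by (intro add_right_mono mult_left_mono) auto
  finally show ?thesis .
qed

lemma orthonormal_seq_sum:
  fixes e :: "nat \<Rightarrow> real ^ 'n::finite \<Rightarrow> real"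
  assumes "orthonormal_seq e"
  shows square_integrable_orthonormal_sum:
      "square_integrable cube_measure (\<lambda>t. \<Sum>k<n. c k * e k t)"
    and integral_orthonormal_sum_square:
      "(\<integral>t. (\<Sum>k<n. c k * e k t)\<^sup>2 \<partial>cube_measure) = (\<Sum>k<n. (c k)\<^sup>2)"
proof -
  have [measurable]: "e k \<in> borel_measurable cube_measure"
    and int_square: "integrable cube_measure (\<lambda>t. (e k t)\<^sup>2)" for k
    using assms by (auto simp: orthonormal_seq_def square_integrable_def)
  have orth: "(\<integral>t. e j t * e k t \<partial>cube_measure) = (if j = k then 1 else 0)" for j k
    using assms by (simp add: orthonormal_seq_def)
  have int: "integrable cube_measure (\<lambda>t. e j t * e k t)" for j k
  proof (rule Bochner_Integration.integrable_bound)
    show "integrable cube_measure (\<lambda>t. (e j t)\<^sup>2 + (e k t)\<^sup>2)"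
      using int_square by simp
    have "\<bar>e j t * e k t\<bar> \<le> (e j t)\<^sup>2 + (e k t)\<^sup>2" for t
      using sum_squares_bound[of "\<bar>e j t\<bar>" "\<bar>e k t\<bar>"] 
        abs_ge_zero[of "e j t * e k t"]
      by (simp only: power2_abs abs_mult)
    then show "AE t in cube_measure. norm (e j t * e k t) \<le> norm ((e j t)\<^sup>2 + (e k t)\<^sup>2)"
      by simp
  qed measurable
  have expand: "(\<Sum>k<n. c k * e k t)\<^sup>2 = (\<Sum>j<n. \<Sum>k<n. c j * c k * (e j t * e k t))" for t
    by (simp add: power2_eq_square sum_product mult_ac)
  show "square_integrable cube_measure (\<lambda>t. \<Sum>k<n. c k * e k t)"
    unfolding square_integrable_def expand using int by auto
  have "(\<integral>t. (\<Sum>k<n. c k * e k t)\<^sup>2 \<partial>cube_measure) =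
      (\<Sum>j<n. \<Sum>k<n. c j * c k * (if j = k then 1 else 0))"
    unfolding expand using int by (simp add: orth)
  also have "\<dots> = (\<Sum>k<n. (c k)\<^sup>2)"
    by (intro sum.cong) (auto simp: power2_eq_square if_distrib cong: if_cong)
  finally show "(\<integral>t. (\<Sum>k<n. c k * e k t)\<^sup>2 \<partial>cube_measure) = (\<Sum>k<n. (c k)\<^sup>2)" .
qed

lemma finite_cube_measure: "finite_measure (cube_measure :: (real ^ 'n::finite) measure)"
  by (intro finite_measureI) (simp add: emeasure_restrict_space emeasure_lborel_cbox_eq)

text \<open>
  Mean-square convergence yields pathwise convergence of the squared norms along the whole
  sequence. By Fatou's lemma almost every path comes arbitrarily close in \<open>L\<^sup>2\<close> to its partial sums
  infinitely often. The squared norms of the partial sums are, by orthonormality, the partial sums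
  of a series of nonnegative terms, so closeness infinitely often already means convergence.
\<close>

lemma kl_series_square_integral:
  fixes e :: "nat \<Rightarrow> real ^ 'n::finite \<Rightarrow> real"
  assumes [measurable]: "\<And>k. \<omega> k \<in> borel_measurable N"
    and l: "\<And>k. 0 \<le> l k" and e: "orthonormal_seq e" and Y: "kl_series_sum N \<omega> l e Y"
  shows "AE y in N. (\<lambda>k. l k * (\<omega> k y)\<^sup>2) sums (\<integral>t. (Y t y)\<^sup>2 \<partial>cube_measure)"
proof -
  interpret T: finite_measure "cube_measure :: (real ^ 'n) measure"
    by (rule finite_cube_measure)
  have [measurable]: "e k \<in> borel_measurable cube_measure" for k
    using e by (auto simp: orthonormal_seq_def square_integrable_def)
  have Y_joint: "(\<lambda>(y, t). Y t y) \<in> borel_measurable (N \<Otimes>\<^sub>M cube_measure)"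
    using Y by (simp add: kl_series_sum_def)
  then have [measurable]: "(\<lambda>x. Y (snd x) (fst x)) \<in> borel_measurable (N \<Otimes>\<^sub>M cube_measure)"
    by (simp add: case_prod_unfold)
  define S where "S n y t = (\<Sum>k<n. (\<omega> k y * sqrt (l k)) * e k t)" for n y t
  define D where "D n y = (\<integral>\<^sup>+t. ennreal ((Y t y - S n y t)\<^sup>2) \<partial>cube_measure)" for n y
  have [measurable]: "D n \<in> borel_measurable N" for n
    unfolding D_def S_def by measurable
  have S: "square_integrable cube_measure (S n y)"
    "(\<integral>t. (S n y t)\<^sup>2 \<partial>cube_measure) = (\<Sum>k<n. l k * (\<omega> k y)\<^sup>2)" for n y
    unfolding S_def integral_orthonormal_sum_square[OF e] using l
    by (simp_all add: square_integrable_orthonormal_sum[OF e] power_mult_distrib mult.commute[of "l _"])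
  have "(\<lambda>n. \<integral>\<^sup>+y. D n y \<partial>N) \<longlonglongrightarrow> 0"
    using Y by (simp add: kl_series_sum_def D_def S_def)
  then have "(\<integral>\<^sup>+y. liminf (\<lambda>n. D n y) \<partial>N) \<le> 0"
    using nn_integral_liminf[of D N] by (simp add: lim_imp_Liminf)
  then have "AE y in N. liminf (\<lambda>n. D n y) = 0"
    by (simp add: nn_integral_0_iff_AE)
  with AE_space show ?thesis
  proof eventually_elim
    case (elim y)
    let ?W = "\<integral>t. (Y t y)\<^sup>2 \<partial>cube_measure"
    note path = joint_measurable_path[OF Y_joint elim(1)]
    have small: "\<exists>\<^sub>F n in sequentially. D n y < ennreal \<eta>" if "0 < \<eta>" for \<eta>
    proof (rule ccontr)
      assume "\<not> (\<exists>\<^sub>F n in sequentially. D n y < ennreal \<eta>)"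
      then have "ennreal \<eta> \<le> liminf (\<lambda>n. D n y)"
        by (intro Liminf_bounded) (simp add: not_frequently not_less)
      with elim(2) that show False
        by simp
    qed
    have "(\<lambda>n. \<Sum>k<n. l k * (\<omega> k y)\<^sup>2) \<longlonglongrightarrow> ?W"
    proof (rule incseq_tendsto_if_frequently_close)
      show "incseq (\<lambda>n. \<Sum>k<n. l k * (\<omega> k y)\<^sup>2)"
        using l by (intro incseq_SucI) simp
      fix \<epsilon> :: real assume "0 < \<epsilon>"
      have "0 \<le> ?W"
        by simp
      \<comment> \<open>In the bound \<open>(1 + 1 / \<delta>) * \<eta> + \<delta> * ?W\<close> the first term is \<open>\<epsilon> / 3\<close>, the second at most \<open>\<epsilon> / 2\<close>.\<close>
      define \<delta> where "\<delta> = \<epsilon> / (2 * (?W + 1))"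
      define \<eta> where "\<eta> = \<epsilon> / (3 * (1 + 1 / \<delta>))"
      have "0 < ?W + 1"
        using \<open>0 \<le> ?W\<close> by linarith
      then have "0 < \<delta>"
        using \<open>0 < \<epsilon>\<close> by (simp add: \<delta>_def del: integral_nonneg)
      then have "0 < 1 + 1 / \<delta>"
        by (simp add: add_pos_pos)
      then have "0 < \<eta>"
        using \<open>0 < \<epsilon>\<close> by (simp add: \<eta>_def)
      have "\<delta> * ?W \<le> \<epsilon> / 2"
        using \<open>0 < \<epsilon>\<close> \<open>0 < ?W + 1\<close> by (simp add: \<delta>_def field_simps)
      moreover have "(1 + 1 / \<delta>) * \<eta> = \<epsilon> / 3"
      proof -
        have "c * (\<epsilon> / (3 * c)) = \<epsilon> / 3" if "0 < c" for c
          using that by simp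
        from this[OF \<open>0 < 1 + 1 / \<delta>\<close>] show ?thesis
          by (simp only: \<eta>_def)
      qed
      ultimately have "\<bar>(\<Sum>k<n. l k * (\<omega> k y)\<^sup>2) - ?W\<bar> < \<epsilon>" if "D n y < ennreal \<eta>" for n
        using integral_square_diff_bound[OF path S(1) that[unfolded D_def] \<open>0 < \<delta>\<close>] \<open>0 < \<epsilon>\<close>
        by (simp add: S(2))
      with small[OF \<open>0 < \<eta>\<close>] show "\<exists>\<^sub>F n in sequentially. \<bar>(\<Sum>k<n. l k * (\<omega> k y)\<^sup>2) - ?W\<bar> < \<epsilon>"
        by (rule frequently_elim1)
    qed
    then show ?case
      by (simp add: sums_def)
  qed
qed

section \<open>Quadratic forms in independent normal variables\<close>

lemma expectation_exp_neg_square: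
  assumes X: "distributed M lborel X std_normal_density" and "0 \<le> a"
  shows "(\<integral>x. exp (- (a * (X x)\<^sup>2)) \<partial>M) = 1 / sqrt (1 + 2 * a)"
proof -
  \<comment> \<open>Up to the factor \<open>\<sigma>\<close>, the exponential turns the standard density into that of variance \<open>\<sigma>\<^sup>2\<close>.\<close>
  define \<sigma> where "\<sigma> = 1 / sqrt (1 + 2 * a)"
  have "0 < \<sigma>" "\<sigma>\<^sup>2 = 1 / (1 + 2 * a)"
    using \<open>0 \<le> a\<close> by (auto simp: \<sigma>_def power_divide)
  have density: "std_normal_density x * exp (- (a * x\<^sup>2)) = \<sigma> * normal_density 0 \<sigma> x" for x
  proof -
    have "- x\<^sup>2 / 2 + - (a * x\<^sup>2) = - x\<^sup>2 / (2 * \<sigma>\<^sup>2)"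
      using \<open>0 \<le> a\<close> by (simp add: \<open>\<sigma>\<^sup>2 = _\<close> field_simps)
    moreover have "sqrt (2 * pi * \<sigma>\<^sup>2) = sqrt (2 * pi) * \<sigma>"
      using \<open>0 < \<sigma>\<close> by (simp add: real_sqrt_mult)
    ultimately show ?thesis
      using \<open>0 < \<sigma>\<close> by (simp add: normal_density_def std_normal_density_def flip: exp_add)
  qed
  have "(\<integral>x. exp (- (a * (X x)\<^sup>2)) \<partial>M) = (\<integral>x. std_normal_density x * exp (- (a * x\<^sup>2)) \<partial>lborel)"
    by (rule distributed_integral[OF X, symmetric]) auto
  also have "\<dots> = \<sigma>"
    using \<open>0 < \<sigma>\<close> by (simp add: density)
  finally show ?thesis
    by (simp add: \<sigma>_def)
qed

text \<open>
  The reciprocal square of the Laplace transform of the quadratic form is the infinite product of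
  the factors \<open>1 + s * (2 * l k)\<close>, by independence and dominated convergence. Convergence of this
  product for \<open>s > 0\<close> also forces the sequence \<open>l\<close> to be summable, since the Laplace transform
  of a finite variable is positive.
\<close>

lemma laplace_transform_quadratic_form:
  assumes \<omega>: "iid_std_normal N \<omega>" and l: "\<And>k. 0 \<le> l k" and "0 \<le> s"
    and [measurable]: "W \<in> borel_measurable N"
    and W: "AE y in N. (\<lambda>k. l k * (\<omega> k y)\<^sup>2) sums W y"
  shows "(\<lambda>n. \<Prod>k<n. 1 + s * (2 * l k)) \<longlonglongrightarrow> inverse ((\<integral>y. exp (- (s * W y)) \<partial>N)\<^sup>2)"
proof -
  interpret N: prob_space N
    using \<omega> by (simp add: iid_std_normal_def)
  have indep: "N.indep_vars (\<lambda>_. borel) \<omega> UNIV"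
    and normal: "distributed N lborel (\<omega> k) std_normal_density" for k
    using \<omega> by (auto simp: iid_std_normal_def)
  have [measurable]: "\<omega> k \<in> borel_measurable N" for k
    using distributed_measurable[OF normal[of k]] by simp
  define f where "f k u = exp (- (s * l k * u\<^sup>2))" for k and u :: real
  have f_bound: "0 < f k u" "f k u \<le> 1" for k u
    using l[of k] \<open>0 \<le> s\<close> by (simp_all add: f_def)
  have prod_bound: "\<bar>\<Prod>k<n. f k (u k)\<bar> \<le> 1" for n u
    unfolding abs_prod using f_bound by (intro prod_le_1) (auto simp: abs_of_pos intro: less_imp_le)
  have [measurable]: "f k \<in> borel_measurable borel" for k
    unfolding f_def by measurable
  have W_nonneg: "AE y in N. 0 \<le> W y"
    using W
  proof eventually_elim
    case (elim y)
    then show ?case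
      using l by (intro sums_le[OF _ sums_zero elim]) simp
  qed
  have "(\<lambda>n. \<integral>y. (\<Prod>k<n. f k (\<omega> k y)) \<partial>N) \<longlonglongrightarrow> (\<integral>y. exp (- (s * W y)) \<partial>N)"
  proof (rule integral_dominated_convergence[where w = "\<lambda>_. 1"])
    show "AE y in N. (\<lambda>n. \<Prod>k<n. f k (\<omega> k y)) \<longlonglongrightarrow> exp (- (s * W y))"
      using W
    proof eventually_elim
      case (elim y)
      have "(\<lambda>n. exp (- (s * (\<Sum>k<n. l k * (\<omega> k y)\<^sup>2)))) \<longlonglongrightarrow> exp (- (s * W y))"
        using elim by (intro tendsto_intros) (simp add: sums_def)
      then show ?case
        by (simp add: f_def exp_sum[symmetric] sum_distrib_left sum_negf mult.assoc)
    qed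
    show "AE y in N. norm (\<Prod>k<n. f k (\<omega> k y)) \<le> 1" for n
      using prod_bound by simp
  qed auto
  moreover have "(\<integral>y. (\<Prod>k<n. f k (\<omega> k y)) \<partial>N) = (\<Prod>k<n. 1 / sqrt (1 + s * (2 * l k)))" for n
  proof -
    have "(\<integral>y. (\<Prod>k<n. f k (\<omega> k y)) \<partial>N) = (\<Prod>k<n. \<integral>y. f k (\<omega> k y) \<partial>N)"
    proof (rule N.indep_vars_lebesgue_integral)
      show "N.indep_vars (\<lambda>_. borel) (\<lambda>k y. f k (\<omega> k y)) {..<n}"
        by (rule N.indep_vars_compose2[OF N.indep_vars_subset[OF indep]]) auto
      show "integrable N (\<lambda>y. f k (\<omega> k y))" for k
        using f_bound by (intro N.integrable_const_bound[of _ 1]) (auto intro: less_imp_le simp: abs_of_pos)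
    qed simp
    then show ?thesis
      using l \<open>0 \<le> s\<close> by (simp add: f_def expectation_exp_neg_square[OF normal] mult.left_commute)
  qed
  ultimately have lim: "(\<lambda>n. \<Prod>k<n. 1 / sqrt (1 + s * (2 * l k))) \<longlonglongrightarrow> (\<integral>y. exp (- (s * W y)) \<partial>N)"
    by simp
  have pos: "0 < (\<integral>y. exp (- (s * W y)) \<partial>N)"
  proof -
    have "integrable N (\<lambda>y. exp (- (s * W y)))"
      using W_nonneg \<open>0 \<le> s\<close> by (intro N.integrable_const_bound[of _ 1]) auto
    then have "(\<integral>y. 0 \<partial>N) < (\<integral>y. exp (- (s * W y)) \<partial>N)"
      by (intro N.integral_less_AE_space) (auto simp: N.emeasure_space_1)
    then show ?thesis
      by simp
  qed
  have "(\<lambda>n. inverse ((\<Prod>k<n. 1 / sqrt (1 + s * (2 * l k)))\<^sup>2)) \<longlonglongrightarrow> inverse ((\<integral>y. exp (- (s * W y)) \<partial>N)\<^sup>2)"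
    using lim pos by (intro tendsto_intros) auto
  moreover have "inverse ((\<Prod>k<n. 1 / sqrt (1 + s * (2 * l k)))\<^sup>2) = (\<Prod>k<n. 1 + s * (2 * l k))" for n
  proof -
    have "(\<Prod>k<n. 1 / sqrt (1 + s * (2 * l k)))\<^sup>2 = (\<Prod>k<n. inverse (1 + s * (2 * l k)))"
      using l \<open>0 \<le> s\<close> by (simp add: prod_power_distrib power_divide inverse_eq_divide)
    also have "\<dots> = inverse (\<Prod>k<n. 1 + s * (2 * l k))"
      using prod_inversef[of "\<lambda>k. 1 + s * (2 * l k)"] by (simp add: comp_def)
    finally show ?thesis
      by simp
  qed
  ultimately show ?thesis
    by simp
qed

text \<open>
  The law does not depend on the probability space that carries the normal variables: it is the
  image of one and the same infinite product measure.
\<close>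

lemma distr_quadratic_form:
  assumes "iid_std_normal N \<omega>"
  shows "distr N borel (\<lambda>y. \<Sum>k. l k * (\<omega> k y)\<^sup>2) =
    distr (Pi\<^sub>M UNIV (\<lambda>_. density lborel std_normal_density)) borel (\<lambda>w. \<Sum>k. l k * (w k)\<^sup>2)"
proof -
  interpret N: prob_space N
    using assms by (simp add: iid_std_normal_def)
  have indep: "N.indep_vars (\<lambda>_. borel) \<omega> UNIV"
    and normal: "distributed N lborel (\<omega> k) std_normal_density" for k
    using assms by (auto simp: iid_std_normal_def)
  have [measurable]: "\<omega> k \<in> borel_measurable N" for k
    using distributed_measurable[OF normal[of k]] by simp
  have marginal: "distr N borel (\<omega> k) = density lborel std_normal_density" for k
    using distributed_distr_eq_density[OF normal[of k]] by (simp cong: distr_cong)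
  have [measurable]: "(\<lambda>w. \<Sum>k. l k * (w k)\<^sup>2) \<in> borel_measurable (Pi\<^sub>M UNIV (\<lambda>_. borel :: real measure))"
    by measurable
  have "distr N (Pi\<^sub>M UNIV (\<lambda>_. borel)) (\<lambda>y k. \<omega> k y) = (\<Pi>\<^sub>M k\<in>UNIV. distr N borel (\<omega> k))"
    using N.indep_vars_iff_distr_eq_PiM[where I = UNIV and X = \<omega> and M' = "\<lambda>_. borel"] indep
    by (simp add: restrict_UNIV)
  then have joint: "distr N (Pi\<^sub>M UNIV (\<lambda>_. borel)) (\<lambda>y k. \<omega> k y) =
      Pi\<^sub>M UNIV (\<lambda>_. density lborel std_normal_density)"
    by (simp add: marginal)
  have "distr N borel (\<lambda>y. \<Sum>k. l k * (\<omega> k y)\<^sup>2) =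
      distr (distr N (Pi\<^sub>M UNIV (\<lambda>_. borel)) (\<lambda>y k. \<omega> k y)) borel (\<lambda>w. \<Sum>k. l k * (w k)\<^sup>2)"
    by (subst distr_distr) (auto simp: comp_def intro!: measurable_PiM_single')
  then show ?thesis
    by (simp add: joint)
qed


section \<open>Infinite products determine their zeros\<close>

lemma summable_if_prod_convergent:
  fixes a :: "nat \<Rightarrow> real"
  assumes "\<And>k. 0 \<le> a k" and "convergent (\<lambda>n. \<Prod>k<n. 1 + a k)"
  shows "summable a"
proof -
  obtain B where B: "\<And>n. norm (\<Prod>k<n. 1 + a k) \<le> B"
    using convergent_imp_Bseq[OF assms(2)] by (auto simp: Bseq_def)
  have "(\<Sum>k\<le>n. a k) \<le> B" for n
  proof -
    have "(\<Sum>k<Suc n. a k) \<le> (\<Prod>k<Suc n. 1 + a k)"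
      by (rule sum_le_prod) (use assms in auto)
    also have "\<dots> \<le> B"
      using B[of "Suc n"] by simp
    finally show "(\<Sum>k\<le>n. a k) \<le> B"
      by (simp add: lessThan_Suc_atMost)
  qed
  with assms(1) show ?thesis
    by (intro bounded_imp_summable)
qed

lemma canonical_product:
  fixes a :: "nat \<Rightarrow> real"
  assumes "\<And>k. 0 \<le> a k" and "summable a"
  shows canonical_product_has_prod:
      "(\<lambda>k. 1 + z * complex_of_real (a k)) has_prod (\<Prod>k. 1 + z * complex_of_real (a k))"
    and canonical_product_holomorphic:
      "(\<lambda>z. \<Prod>k. 1 + z * complex_of_real (a k)) holomorphic_on UNIV"
proof -
  have hp: "(\<lambda>k. 1 + z * complex_of_real (a k)) has_prod (\<Prod>k. 1 + z * complex_of_real (a k))" for z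
  proof -
    have "summable (\<lambda>k. norm (z * complex_of_real (a k)))"
      using assms by (simp add: norm_mult summable_mult)
    then have "abs_convergent_prod (\<lambda>k. 1 + z * complex_of_real (a k))"
      by (simp add: abs_convergent_prod_conv_summable)
    then show ?thesis
      by (simp add: abs_convergent_prod_imp_convergent_prod convergent_prod_has_prod)
  qed
  then show "(\<lambda>k. 1 + z * complex_of_real (a k)) has_prod (\<Prod>k. 1 + z * complex_of_real (a k))"
    for z .
  let ?P = "\<lambda>n z. \<Prod>k<n. 1 + z * complex_of_real (a k)"
  let ?f = "\<lambda>z. \<Prod>k. 1 + z * complex_of_real (a k)"
  have lim: "(\<lambda>n. ?P n z) \<longlonglongrightarrow> ?f z" for z
    using convergent_prod_LIMSEQ[of "\<lambda>k. 1 + z * complex_of_real (a k)"] hp[of z]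
    by (simp add: LIMSEQ_lessThan_iff_atMost has_prod_iff)
  have unif: "uniform_limit (cball z 1) ?P ?f sequentially" for z
  proof -
    have "uniformly_convergent_on (cball z 1) (\<lambda>N x. \<Sum>n<N. norm (x * complex_of_real (a n)))"
    proof (rule Weierstrass_m_test')
      fix n x assume "x \<in> cball z 1"
      then have "norm x \<le> norm z + 1"
        by (smt (verit) dist_norm mem_cball norm_minus_commute norm_triangle_sub)
      then show "norm (norm (x * complex_of_real (a n))) \<le> (norm z + 1) * a n"
        using assms by (simp add: norm_mult mult_right_mono)
    qed (use assms in \<open>simp add: summable_mult\<close>)
    then have "uniformly_convergent_on (cball z 1) ?P"
      by (intro uniformly_convergent_on_prod) (auto intro!: continuous_intros)
    then obtain g where g: "uniform_limit (cball z 1) ?P g sequentially"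
      by (auto simp: uniformly_convergent_on_def)
    have "g x = ?f x" if "x \<in> cball z 1" for x
      using tendsto_uniform_limitI[OF g that] lim[of x] LIMSEQ_unique by blast
    with g show ?thesis
      by (metis (no_types, lifting) uniform_limit_cong')
  qed
  show "?f holomorphic_on UNIV"
  proof (rule holomorphic_uniform_sequence)
    show "\<exists>d>0. cball z d \<subseteq> UNIV \<and> uniform_limit (cball z d) ?P ?f sequentially" for z
      using unif[of z] by (intro exI[of _ 1]) auto
  qed (auto intro!: holomorphic_intros)
qed

lemma canonical_product_of_real:
  fixes a :: "nat \<Rightarrow> real"
  assumes "\<And>k. 0 \<le> a k" and "summable a" and "(\<lambda>n. \<Prod>k<n. 1 + s * a k) \<longlonglongrightarrow> p"
  shows "(\<Prod>k. 1 + complex_of_real s * complex_of_real (a k)) = complex_of_real p"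
proof -
  have "(\<lambda>n. \<Prod>k<n. 1 + complex_of_real s * complex_of_real (a k))
      \<longlonglongrightarrow> (\<Prod>k. 1 + complex_of_real s * complex_of_real (a k))"
    using convergent_prod_LIMSEQ[of "\<lambda>k. 1 + complex_of_real s * complex_of_real (a k)"]
      canonical_product_has_prod[OF assms(1,2), of "complex_of_real s"]
    by (simp add: LIMSEQ_lessThan_iff_atMost has_prod_iff)
  moreover have "(\<lambda>n. \<Prod>k<n. 1 + complex_of_real s * complex_of_real (a k)) \<longlonglongrightarrow> complex_of_real p"
    using tendsto_of_real[OF assms(3), where 'a = complex] by simp
  ultimately show ?thesis
    by (rule LIMSEQ_unique)
qed

text \<open>
  The two products extend to entire functions of \<open>s\<close> that agree on the positive half-line, hence
  everywhere. The first one vanishes at \<open>-1 / a j\<close>, so some factor of the second one vanishes there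
  as well.
\<close>

lemma product_determines_zeros:
  fixes a b :: "nat \<Rightarrow> real"
  assumes a: "\<And>k. 0 \<le> a k" and b: "\<And>k. 0 \<le> b k"
    and lim_a: "\<And>s. 0 \<le> s \<Longrightarrow> (\<lambda>n. \<Prod>k<n. 1 + s * a k) \<longlonglongrightarrow> P s"
    and lim_b: "\<And>s. 0 \<le> s \<Longrightarrow> (\<lambda>n. \<Prod>k<n. 1 + s * b k) \<longlonglongrightarrow> P s"
    and pos: "0 < a j"
  shows "\<exists>k. b k = a j"
proof -
  have sum_a: "summable a" and sum_b: "summable b"
    using lim_a[of 1] lim_b[of 1] by (auto intro!: summable_if_prod_convergent a b convergentI)
  define f where "f z = (\<Prod>k. 1 + z * complex_of_real (a k))" for z
  define g where "g z = (\<Prod>k. 1 + z * complex_of_real (b k))" for z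
  define z where "z = complex_of_real (- 1 / a j)"
  have "f z - g z = 0"
  proof (rule analytic_continuation[where S = UNIV and U = "complex_of_real ` {0..}" and \<xi> = 0 and w = z
        and f = "\<lambda>z. f z - g z"])
    show "(\<lambda>z. f z - g z) holomorphic_on UNIV"
      unfolding f_def g_def
      by (intro holomorphic_intros canonical_product_holomorphic a b sum_a sum_b)
    show "0 islimpt complex_of_real ` {0..}"
    proof (rule islimpt_approachable[THEN iffD2], safe)
      fix e :: real assume "0 < e"
      then show "\<exists>x'\<in>complex_of_real ` {0..}. x' \<noteq> 0 \<and> dist x' 0 < e"
        by (intro bexI[OF _ imageI[of "e / 2"]]) auto
    qed
    show "f w - g w = 0" if "w \<in> complex_of_real ` {0..}" for w
      using that canonical_product_of_real[OF a sum_a lim_a] canonical_product_of_real[OF b sum_b lim_b]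
      by (auto simp: f_def g_def)
  qed auto
  moreover have "f z = 0"
  proof -
    have "1 + z * complex_of_real (a j) = 0"
      using pos by (simp add: z_def field_simps flip: of_real_mult)
    then show ?thesis
      using has_prod_eq_0_iff[OF canonical_product_has_prod[OF a sum_a, of z]]
      by (force simp: f_def)
  qed
  ultimately have "0 \<in> range (\<lambda>k. 1 + z * complex_of_real (b k))"
    using has_prod_eq_0_iff[OF canonical_product_has_prod[OF b sum_b, of z]] by (simp add: g_def)
  then obtain k where "1 + z * complex_of_real (b k) = 0"
    by auto
  then have "1 + (- 1 / a j) * b k = 0"
    unfolding z_def by (metis of_real_1 of_real_add of_real_eq_0_iff of_real_mult)
  with pos show ?thesis
    by (intro exI[of _ k]) (simp add: field_simps)
qed

text \<open>
  The largest entries of the two sequences belong to the zeros nearest to the origin, so they agree.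
  Removing the corresponding factors and repeating the argument compares the next entries. This takes
  care of multiplicities.
\<close>

lemma decseq_eq_if_products_eq:
  fixes a b :: "nat \<Rightarrow> real"
  assumes dec: "decseq a" "decseq b"
    and nonneg: "\<And>k. 0 \<le> a k" "\<And>k. 0 \<le> b k"
    and lim_a: "\<And>s. 0 \<le> s \<Longrightarrow> (\<lambda>n. \<Prod>k<n. 1 + s * a k) \<longlonglongrightarrow> P s"
    and lim_b: "\<And>s. 0 \<le> s \<Longrightarrow> (\<lambda>n. \<Prod>k<n. 1 + s * b k) \<longlonglongrightarrow> P s"
  shows "a m = b m"
proof -
  have le: "u 0 \<le> v 0"
    if "\<And>k. 0 \<le> u k" "\<And>k. 0 \<le> v k" "decseq v"
      "\<And>s. 0 \<le> s \<Longrightarrow> (\<lambda>n. \<Prod>k<n. 1 + s * u k) \<longlonglongrightarrow> Q s"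
      "\<And>s. 0 \<le> s \<Longrightarrow> (\<lambda>n. \<Prod>k<n. 1 + s * v k) \<longlonglongrightarrow> Q s"
    for u v :: "nat \<Rightarrow> real" and Q
  proof (cases "u 0 = 0")
    case True
    with that(2) show ?thesis by simp
  next
    case False
    with that(1)[of 0] have "0 < u 0" by simp
    then have "\<exists>k. v k = u 0"
      using product_determines_zeros[OF that(1,2,4,5)] by blast
    with that(3) show ?thesis
      by (metis decseq_def zero_le)
  qed
  have eq: "u 0 = v 0"
    if "\<And>k. 0 \<le> u k" "\<And>k. 0 \<le> v k" "decseq u" "decseq v"
      "\<And>s. 0 \<le> s \<Longrightarrow> (\<lambda>n. \<Prod>k<n. 1 + s * u k) \<longlonglongrightarrow> Q s"
      "\<And>s. 0 \<le> s \<Longrightarrow> (\<lambda>n. \<Prod>k<n. 1 + s * v k) \<longlonglongrightarrow> Q s"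
    for u v :: "nat \<Rightarrow> real" and Q
    using le[OF that(1,2,4,5,6)] le[OF that(2,1,3,6,5)] by simp
  \<comment> \<open>Dividing the products by their common first factor leaves the same hypotheses for the tails.\<close>
  have tail: "(\<lambda>n. \<Prod>k<n. 1 + s * u (Suc k)) \<longlonglongrightarrow> Q s / (1 + s * u 0)"
    if "\<And>k. 0 \<le> u k" "(\<lambda>n. \<Prod>k<n. 1 + s * u k) \<longlonglongrightarrow> Q s" "0 \<le> s"
    for u :: "nat \<Rightarrow> real" and Q :: "real \<Rightarrow> real" and s
  proof -
    have "0 < 1 + s * u 0"
      using that by (simp add: add_pos_nonneg)
    then have "(\<lambda>n. (\<Prod>k<Suc n. 1 + s * u k) / (1 + s * u 0)) \<longlonglongrightarrow> Q s / (1 + s * u 0)"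
      by (intro tendsto_intros LIMSEQ_Suc[OF that(2)]) auto
    moreover have "(\<Prod>k<Suc n. 1 + s * u k) / (1 + s * u 0) = (\<Prod>k<n. 1 + s * u (Suc k))" for n
      using \<open>0 < 1 + s * u 0\<close> by (subst prod.lessThan_Suc_shift) simp
    ultimately show ?thesis
      by simp
  qed
  show ?thesis
    using assms
  proof (induction m arbitrary: a b P)
    case 0
    then show ?case by (intro eq)
  next
    case (Suc m)
    have "a 0 = b 0"
      using Suc.prems by (intro eq)
    show ?case
    proof (rule Suc.IH[of "\<lambda>k. a (Suc k)" "\<lambda>k. b (Suc k)" "\<lambda>s. P s / (1 + s * a 0)"])
      show "(\<lambda>n. \<Prod>k<n. 1 + s * a (Suc k)) \<longlonglongrightarrow> P s / (1 + s * a 0)"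
        "(\<lambda>n. \<Prod>k<n. 1 + s * b (Suc k)) \<longlonglongrightarrow> P s / (1 + s * a 0)" if "0 \<le> s" for s
        using tail[where Q = P, OF Suc.prems(3,5)] tail[where Q = P, OF Suc.prems(4,6)] that \<open>a 0 = b 0\<close>
        by auto
    qed (use Suc.prems in \<open>auto simp: decseq_Suc_iff\<close>)
  qed
qed

section \<open>The law of the integrated squared process\<close>

lemma square_integral_eq_law_quadratic_form:
  fixes \<zeta> :: "real ^ 'n::finite \<Rightarrow> 'a \<Rightarrow> real" and N :: "'b measure"
  assumes \<zeta>: "centered_gaussian_process M \<zeta>" and kl: "kl_expansion M \<zeta> N \<omega> l e"
  obtains W where "W \<in> borel_measurable N" and "AE y in N. (\<lambda>k. l k * (\<omega> k y)\<^sup>2) sums W y"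
    and "distr M borel (\<lambda>x. \<integral>t. (\<zeta> t x)\<^sup>2 \<partial>cube_measure) = distr N borel W"
proof -
  obtain Y Z where Y: "kl_series_sum N \<omega> l e Y" and Z: "Z \<in> null_sets cube_measure"
    and law: "process_eq_law (cube - Z) M \<zeta> N Y"
    using kl by (auto simp: kl_expansion_def)
  have \<omega>: "iid_std_normal N \<omega>" and l: "\<And>k. 0 \<le> l k" and e: "orthonormal_seq e"
    using kl by (auto simp: kl_expansion_def eigensystem_def)
  interpret N: prob_space N
    using \<omega> by (simp add: iid_std_normal_def)
  interpret T: finite_measure "cube_measure :: (real ^ 'n) measure"
    by (rule finite_cube_measure)
  have Y_joint: "(\<lambda>(y, t). Y t y) \<in> borel_measurable (N \<Otimes>\<^sub>M cube_measure)"
    using Y by (simp add: kl_series_sum_def)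
  then have [measurable]: "(\<lambda>x. Y (snd x) (fst x)) \<in> borel_measurable (N \<Otimes>\<^sub>M cube_measure)"
    by (simp add: case_prod_unfold)
  show thesis
  proof
    show "(\<lambda>y. \<integral>t. (Y t y)\<^sup>2 \<partial>cube_measure) \<in> borel_measurable N"
      by measurable
    show "AE y in N. (\<lambda>k. l k * (\<omega> k y)\<^sup>2) sums (\<integral>t. (Y t y)\<^sup>2 \<partial>cube_measure)"
    proof (rule kl_series_square_integral[OF _ l e Y])
      show "\<omega> k \<in> borel_measurable N" for k
        using \<omega> distributed_measurable by (fastforce simp: iid_std_normal_def)
    qed
    show "distr M borel (\<lambda>x. \<integral>t. (\<zeta> t x)\<^sup>2 \<partial>cube_measure) =
        distr N borel (\<lambda>y. \<integral>t. (Y t y)\<^sup>2 \<partial>cube_measure)"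
    proof (rule distr_integral_eq_if_process_eq_law[OF _ N.prob_space_axioms T.finite_measure_axioms
          _ Y_joint Z])
      show "prob_space M" "(\<lambda>(x, t). \<zeta> t x) \<in> borel_measurable (M \<Otimes>\<^sub>M cube_measure)"
        using \<zeta> by (auto simp: centered_gaussian_process_def)
      show "process_eq_law (space cube_measure - Z) M \<zeta> N Y"
        using law by (simp add: space_restrict_space)
    qed auto
  qed
qed

lemma square_integral_law:
  fixes \<zeta> :: "real ^ 'n::finite \<Rightarrow> 'a \<Rightarrow> real" and N :: "'b measure"
  assumes \<zeta>: "centered_gaussian_process M \<zeta>" and kl: "kl_expansion M \<zeta> N \<omega> l e"
  shows square_integral_law_eq_canonical:
      "distr M borel (\<lambda>x. \<integral>t. (\<zeta> t x)\<^sup>2 \<partial>cube_measure) =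
        distr (Pi\<^sub>M UNIV (\<lambda>_. density lborel std_normal_density)) borel (\<lambda>w. \<Sum>k. l k * (w k)\<^sup>2)"
    and square_integral_law_laplace: "0 \<le> s \<Longrightarrow> (\<lambda>n. \<Prod>k<n. 1 + s * (2 * l k)) \<longlonglongrightarrow>
      inverse ((\<integral>x. exp (- (s * x)) \<partial>distr M borel (\<lambda>x. \<integral>t. (\<zeta> t x)\<^sup>2 \<partial>cube_measure))\<^sup>2)"
proof -
  have \<omega>: "iid_std_normal N \<omega>" and l: "\<And>k. 0 \<le> l k"
    using kl by (auto simp: kl_expansion_def eigensystem_def)
  have [measurable]: "\<omega> k \<in> borel_measurable N" for k
    using \<omega> distributed_measurable by (fastforce simp: iid_std_normal_def)
  obtain W where W[measurable]: "W \<in> borel_measurable N"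
    and sums: "AE y in N. (\<lambda>k. l k * (\<omega> k y)\<^sup>2) sums W y"
    and law: "distr M borel (\<lambda>x. \<integral>t. (\<zeta> t x)\<^sup>2 \<partial>cube_measure) = distr N borel W"
    using square_integral_eq_law_quadratic_form[OF \<zeta> kl] .
  have "distr N borel W = distr N borel (\<lambda>y. \<Sum>k. l k * (\<omega> k y)\<^sup>2)"
  proof (rule distr_cong_AE)
    show "AE y in N. W y = (\<Sum>k. l k * (\<omega> k y)\<^sup>2)"
      using sums by eventually_elim (rule sums_unique)
  qed simp_all
  then show "distr M borel (\<lambda>x. \<integral>t. (\<zeta> t x)\<^sup>2 \<partial>cube_measure) =
      distr (Pi\<^sub>M UNIV (\<lambda>_. density lborel std_normal_density)) borel (\<lambda>w. \<Sum>k. l k * (w k)\<^sup>2)"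
    unfolding law by (simp only: distr_quadratic_form[OF \<omega>])
  show "(\<lambda>n. \<Prod>k<n. 1 + s * (2 * l k)) \<longlonglongrightarrow>
      inverse ((\<integral>x. exp (- (s * x)) \<partial>distr M borel (\<lambda>x. \<integral>t. (\<zeta> t x)\<^sup>2 \<partial>cube_measure))\<^sup>2)" if "0 \<le> s"
    unfolding law using laplace_transform_quadratic_form[OF \<omega> l that W sums]
    by (simp add: integral_distr)
qed

theorem theorem1p2:
  fixes M\<^sub>1 :: "'a measure" and M\<^sub>2 :: "'b measure"
    and N\<^sub>1 :: "'c measure" and N\<^sub>2 :: "'d measure"
    and \<zeta>\<^sub>1 :: "real ^ 'n::finite \<Rightarrow> 'a \<Rightarrow> real" and \<zeta>\<^sub>2 :: "real ^ 'n \<Rightarrow> 'b \<Rightarrow> real"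
    and \<omega>\<^sub>1 :: "nat \<Rightarrow> 'c \<Rightarrow> real" and \<omega>\<^sub>2 :: "nat \<Rightarrow> 'd \<Rightarrow> real"
    and l\<^sub>1 l\<^sub>2 :: "nat \<Rightarrow> real"
    and e\<^sub>1 e\<^sub>2 :: "nat \<Rightarrow> real ^ 'n \<Rightarrow> real"
  assumes "centered_gaussian_process M\<^sub>1 \<zeta>\<^sub>1"
    and "centered_gaussian_process M\<^sub>2 \<zeta>\<^sub>2"
    and "square_integrable (cube_measure \<Otimes>\<^sub>M cube_measure) (\<lambda>(s, t). covariance_fun M\<^sub>1 \<zeta>\<^sub>1 s t)"
    and "square_integrable (cube_measure \<Otimes>\<^sub>M cube_measure) (\<lambda>(s, t). covariance_fun M\<^sub>2 \<zeta>\<^sub>2 s t)"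
    and "kl_expansion M\<^sub>1 \<zeta>\<^sub>1 N\<^sub>1 \<omega>\<^sub>1 l\<^sub>1 e\<^sub>1"
    and "kl_expansion M\<^sub>2 \<zeta>\<^sub>2 N\<^sub>2 \<omega>\<^sub>2 l\<^sub>2 e\<^sub>2"
  shows "distr M\<^sub>1 borel (\<lambda>x. \<integral>t. (\<zeta>\<^sub>1 t x)\<^sup>2 \<partial>cube_measure) =
         distr M\<^sub>2 borel (\<lambda>x. \<integral>t. (\<zeta>\<^sub>2 t x)\<^sup>2 \<partial>cube_measure)
    \<longleftrightarrow> (\<forall>k. l\<^sub>1 k = l\<^sub>2 k)"
proof
  assume eq: "distr M\<^sub>1 borel (\<lambda>x. \<integral>t. (\<zeta>\<^sub>1 t x)\<^sup>2 \<partial>cube_measure) =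
    distr M\<^sub>2 borel (\<lambda>x. \<integral>t. (\<zeta>\<^sub>2 t x)\<^sup>2 \<partial>cube_measure)"
  have l: "decseq l\<^sub>1" "decseq l\<^sub>2" "0 \<le> l\<^sub>1 k" "0 \<le> l\<^sub>2 k" for k
    using assms(5,6) by (auto simp: kl_expansion_def eigensystem_def)
  have "2 * l\<^sub>1 k = 2 * l\<^sub>2 k" for k
  proof (rule decseq_eq_if_products_eq)
    show "decseq (\<lambda>k. 2 * l\<^sub>1 k)" "decseq (\<lambda>k. 2 * l\<^sub>2 k)"
      using l by (simp_all add: decseq_def)
  qed (use l square_integral_law_laplace[OF assms(1,5)] square_integral_law_laplace[OF assms(2,6)]
      in \<open>simp_all add: eq\<close>)
  then show "\<forall>k. l\<^sub>1 k = l\<^sub>2 k"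
    by simp
next
  assume "\<forall>k. l\<^sub>1 k = l\<^sub>2 k"
  then show "distr M\<^sub>1 borel (\<lambda>x. \<integral>t. (\<zeta>\<^sub>1 t x)\<^sup>2 \<partial>cube_measure) =
      distr M\<^sub>2 borel (\<lambda>x. \<integral>t. (\<zeta>\<^sub>2 t x)\<^sup>2 \<partial>cube_measure)"
    by (simp add: square_integral_law_eq_canonical[OF assms(1,5)]
        square_integral_law_eq_canonical[OF assms(2,6)])
qed

end
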